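(* Let $T$ be a tree with at least one edge. Then $v\bigl(J(T)^t\bigr)$ is a linear function of $t$ for all integers $t\ge 1$; that is, there are integers $a,b$ such that $v(J(T)^t)=at+b$ for all $t\ge 1$.
   Context: A tree is a (finite, simple) connected acyclic graph. Let $T$ have vertex set $\{1,\ldots,n\}$ and edge set $E(T)$, and let $S=\mathbf{k}[x_1,\ldots,x_n]$ be the standard graded polynomial ring over a field $\mathbf{k}$, with degree-$d$ component $S_d$. The cover ideal of $T$ is $J(T)=\bigcap_{\{i,j\}\in E(T)}(x_i,x_j)\subseteq S$. For a nonzero homogeneous ideal $I$ of $S$ with set of associated primes $\operatorname{Ass}(I)$, and $P\in\operatorname{Ass}(I)$, the local $v$-number is $v_P(I)=\min\{d\ge 0\mid \text{there exists } f\in S_d\text{ with } I:f=P\}$. The (global) $v$-number is $v(I)=\min_{P\in\operatorname{Ass}(I)}v_P(I)$. *)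

theory Defs
  imports
    "HOL-Library.Poly_Mapping"
    "HOL-Algebra.Ideal_Product"
    "HOL-Algebra.Algebraic_Closure_Type"
    "Graph_Theory.Graph_Theory"
begin

text \<open>
  Undirected simple graphs are the finite, loop-free symmetric digraphs of \<^locale>\<open>pair_graph\<close>:
  the edge \<open>{i, j}\<close> is the pair of arcs \<open>(i, j)\<close> and \<open>(j, i)\<close>. In this encoding every edge gives
  a directed cycle of length 2, so the predicate \<open>tree\<close> of the library (connected and without
  directed cycles) holds for no such graph with an edge. The cycles of the undirected graph are
  exactly the directed cycles of length at least 3.
\<close>

definition undirected_tree :: "'v pair_pre_digraph \<Rightarrow> bool" where
  "undirected_tree T \<longleftrightarrow>
     pair_graph T \<and> Digraph_Component.connected (with_proj T) \<and>
     \<not> (\<exists>p. pre_digraph.cycle (with_proj T) p \<and> 3 \<le> length p)"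

text \<open>
  The polynomial ring over \<open>'k\<close> in the variables \<open>x\<^sub>i\<close> with \<open>i\<close> ranging over the finite type \<open>'v\<close>:
  a polynomial maps exponent vectors to coefficients.
\<close>

type_synonym ('v, 'k) mpoly = "('v \<Rightarrow>\<^sub>0 nat) \<Rightarrow>\<^sub>0 'k"

abbreviation mpoly_ring :: "('v::finite, 'k::field) mpoly ring" where
  "mpoly_ring \<equiv> ring_of_type_algebra"

definition mvar :: "'v::finite \<Rightarrow> ('v, 'k::field) mpoly" where
  "mvar i = Poly_Mapping.single (Poly_Mapping.single i 1) 1"

definition homogeneous_component :: "nat \<Rightarrow> ('v::finite, 'k::field) mpoly set" where
  "homogeneous_component d =
     {f. \<forall>m \<in> Poly_Mapping.keys f. (\<Sum>i\<in>UNIV. Poly_Mapping.lookup m i) = d}"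

definition cover_ideal :: "'v::finite pair_pre_digraph \<Rightarrow> ('v, 'k::field) mpoly set" where
  "cover_ideal T = (\<Inter>(i, j) \<in> parcs T. Idl\<^bsub>mpoly_ring\<^esub> {mvar i, mvar j})"

definition colon_ideal :: "('a, 'b) ring_scheme \<Rightarrow> 'a set \<Rightarrow> 'a \<Rightarrow> 'a set" where
  "colon_ideal R I f = {g \<in> carrier R. g \<otimes>\<^bsub>R\<^esub> f \<in> I}"

text \<open>The associated primes of the module \<open>R/I\<close>; \<open>I : f\<close> is the annihilator of the class of \<open>f\<close>.\<close>

definition associated_primes :: "('a, 'b) ring_scheme \<Rightarrow> 'a set \<Rightarrow> 'a set set" where
  "associated_primes R I = {P. primeideal P R \<and> (\<exists>f \<in> carrier R. colon_ideal R I f = P)}"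

text \<open>
  Every associated prime of a homogeneous ideal is \<open>I : f\<close> for some homogeneous \<open>f\<close>, and a proper
  ideal of the (Noetherian) polynomial ring has an associated prime. Hence for proper homogeneous
  \<open>I\<close> and \<open>P\<close> associated to \<open>I\<close> both minima below are taken over nonempty sets of naturals.
\<close>

definition local_v_number ::
    "('v::finite, 'k::field) mpoly set \<Rightarrow> ('v, 'k) mpoly set \<Rightarrow> nat" where
  "local_v_number I P =
     (LEAST d. \<exists>f \<in> homogeneous_component d. colon_ideal mpoly_ring I f = P)"

definition v_number :: "('v::finite, 'k::field) mpoly set \<Rightarrow> nat" where
  "v_number I = (INF P \<in> associated_primes mpoly_ring I. local_v_number I P)"

text \<open>Powers are taken in the multiplicative monoid of ideals, i.e. with respect to \<^const>\<open>ideal_prod\<close>.\<close>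

abbreviation ideal_power :: "('v::finite, 'k::field) mpoly set \<Rightarrow> nat \<Rightarrow> ('v, 'k) mpoly set" where
  "ideal_power I t \<equiv> I [^]\<^bsub>ideals_set mpoly_ring\<^esub> t"

end

theory Submission
  imports Defs
begin

text \<open>
  Call a weight \<open>m : V \<rightarrow> \<nat>\<close> a \<open>t\<close>-cover if \<open>m x + m y \<ge> t\<close> on every edge. In a bipartite graph every
  \<open>(t + 1)\<close>-cover is the sum of a 1-cover and a \<open>t\<close>-cover (\<open>peel_cover\<close>), so \<open>J(T)\<^sup>t\<close> is the
  symbolic power spanned by the monomials whose exponents are \<open>t\<close>-covers, which is
  the intersection of the powers \<open>(x\<^sub>i, x\<^sub>j)\<^sup>t\<close>. These powers are primary, hence the associated
  primes of \<open>J(T)\<^sup>t\<close> are among the edge primes \<open>(x\<^sub>i, x\<^sub>j)\<close>. If \<open>J(T)\<^sup>t : f = (x\<^sub>i, x\<^sub>j)\<close>, then some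
  monomial of \<open>f\<close> has an exponent \<open>m\<close> with \<open>m i + m j = t - 1\<close> and \<open>m x + m y \<ge> t\<close> on all other edges;
  conversely, every monomial with such an exponent has this colon ideal. Call such an \<open>m\<close> an almost
  cover at \<open>ij\<close>. Then \<open>v(J(T)\<^sup>t)\<close> is the least weight \<open>\<Sum> m\<close> of an almost cover, over all edges.

  Let \<open>\<tau>\<close> be the least weight of a 1-cover and \<open>\<beta>\<close> the least weight of an almost cover for \<open>t = 1\<close>.
  The minimum is \<open>(t - 1) \<tau> + \<beta>\<close>. The lower bound holds since a 1-cover can also be peeled off an
  almost cover while \<open>t \<ge> 2\<close> (\<open>peel_almost_cover\<close>). For the upper bound, take an optimal
  almost cover \<open>s\<close> for \<open>t = 1\<close>, at the edge \<open>ij\<close>. If a minimum 1-cover \<open>c\<close> has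
  \<open>c i + c j = 1\<close>, then \<open>s + (t - 1) c\<close> is an almost cover of the required weight. Such a \<open>c\<close> exists
  in a tree (\<open>exchange\<close>): otherwise every minimum cover is positive at both ends of \<open>ij\<close>, and
  replacing \<open>s\<close> by \<open>c\<close> on suitable branches of the tree at \<open>i\<close> gives a lighter almost cover,
  at the edge \<open>ij\<close> or at another edge \<open>ik\<close>.
\<close>

section \<open>Covers and almost covers\<close>

text \<open>
  A \<open>t\<close>-cover: a natural weight on the vertices that is at least \<open>t\<close> on every edge. The 1-covers with
  values in \<open>{0, 1}\<close> are the vertex covers.
\<close>

definition fractional_cover :: "('v \<times> 'v) set \<Rightarrow> nat \<Rightarrow> ('v \<Rightarrow> nat) \<Rightarrow> bool" where
  "fractional_cover E t m \<longleftrightarrow> (\<forall>(x, y) \<in> E. t \<le> m x + m y)"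

text \<open>
  A weight that fails to be a \<open>t\<close>-cover at the edge \<open>ij\<close> only, and fails there by exactly one. Both
  orientations of \<open>ij\<close> are exempt. For \<open>t = 0\<close> there is no such weight.
\<close>

definition almost_cover :: "('v \<times> 'v) set \<Rightarrow> nat \<Rightarrow> 'v \<Rightarrow> 'v \<Rightarrow> ('v \<Rightarrow> nat) \<Rightarrow> bool" where
  "almost_cover E t i j m \<longleftrightarrow> (i, j) \<in> E \<and> m i + m j + 1 = t \<and>
     fractional_cover (E - {(i, j), (j, i)}) t m"

lemma cover_edge: "fractional_cover E t m \<Longrightarrow> (x, y) \<in> E \<Longrightarrow> t \<le> m x + m y"
  by (auto simp: fractional_cover_def)

text \<open>
  One level of a \<open>(t + 1)\<close>-cover \<open>m\<close> of a graph with 2-colouring \<open>col\<close>: the vertices of colour \<open>b\<close> with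
  \<open>m \<ge> t + 1\<close> and the vertices of the other colour with \<open>m \<ge> 1\<close>. It is a vertex cover, and removing it
  from \<open>m\<close> lowers an edge of weight exactly \<open>t + 1\<close> by one only.
\<close>

definition level_cover :: "('v \<Rightarrow> bool) \<Rightarrow> bool \<Rightarrow> nat \<Rightarrow> ('v \<Rightarrow> nat) \<Rightarrow> 'v \<Rightarrow> nat" where
  "level_cover col b t m v = (if (if col v = b then Suc t \<le> m v else 1 \<le> m v) then 1 else 0)"

lemma level_cover_le: "level_cover col b t m v \<le> m v"
  by (simp add: level_cover_def)

lemma level_cover_edge:
  assumes "col x \<noteq> col y" and "Suc t \<le> m x + m y"
  shows "1 \<le> level_cover col b t m x + level_cover col b t m y"
    and "t \<le> (m x - level_cover col b t m x) + (m y - level_cover col b t m y)"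
  using assms by (auto simp: level_cover_def)

text \<open>The weight that is \<open>f\<close> on \<open>A\<close> and \<open>g\<close> elsewhere.\<close>

definition patch :: "'v set \<Rightarrow> ('v \<Rightarrow> nat) \<Rightarrow> ('v \<Rightarrow> nat) \<Rightarrow> 'v \<Rightarrow> nat" where
  "patch A f g v = (if v \<in> A then f v else g v)"

lemma sum_patch:
  fixes f :: "'v::finite \<Rightarrow> nat"
  shows "sum (patch A f g) UNIV = sum f A + sum g (- A)"
proof -
  have "sum (patch A f g) UNIV = sum (patch A f g) A + sum (patch A f g) (- A)"
    by (metis Compl_eq_Diff_UNIV add.commute finite subset_UNIV sum.subset_diff)
  also have "sum (patch A f g) A = sum f A"
    by (rule sum.cong) (auto simp: patch_def)
  also have "sum (patch A f g) (- A) = sum g (- A)"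
    by (rule sum.cong) (auto simp: patch_def)
  finally show ?thesis .
qed

lemma sum_split: "sum f UNIV = sum f A + sum f (- A)" for f :: "'v::finite \<Rightarrow> nat"
  using sum_patch[of A f f] by (simp add: patch_def[abs_def])

section \<open>Branches of a tree\<close>

text \<open>
  A tree on the whole finite type \<open>'v\<close>, given by its set of arcs in both directions: a connected
  graph in which every edge is a bridge.
\<close>

locale edge_tree =
  fixes E :: "('v::finite \<times> 'v) set"
  assumes sym: "(x, y) \<in> E \<Longrightarrow> (y, x) \<in> E"
    and irrefl: "(x, x) \<notin> E"
    and conn: "(x, y) \<in> E\<^sup>*"
    and bridge: "(x, y) \<in> E \<Longrightarrow> (x, y) \<notin> (E - {(x, y), (y, x)})\<^sup>*"
begin

text \<open>
  The component of \<open>x\<close> after deletion of the edge \<open>xy\<close>. The edge \<open>xy\<close> is the only one that leaves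
  it.
\<close>

definition branch :: "'v \<Rightarrow> 'v \<Rightarrow> 'v set" where
  "branch x y = {v. (x, v) \<in> (E - {(x, y), (y, x)})\<^sup>*}"

lemma self_in_branch: "x \<in> branch x y"
  by (simp add: branch_def)

lemma other_notin_branch: "(x, y) \<in> E \<Longrightarrow> y \<notin> branch x y"
  using bridge by (simp add: branch_def)

lemma branch_step:
  assumes "u \<in> branch x y" "(u, v) \<in> E" "(u, v) \<noteq> (x, y)" "(u, v) \<noteq> (y, x)"
  shows "v \<in> branch x y"
  using assms by (auto simp: branch_def intro: rtrancl_into_rtrancl)

lemma branch_boundary:
  assumes "(x, y) \<in> E" "u \<in> branch x y" "(u, v) \<in> E" "v \<notin> branch x y"
  shows "u = x" "v = y"
  using branch_step[OF assms(2,3)] assms(4) other_notin_branch[OF assms(1)] assms(2) by auto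

lemma branch_disjoint:
  assumes k: "(k, i) \<in> E" and l: "(l, i) \<in> E" and ne: "k \<noteq> l"
  shows "branch k i \<inter> branch l i = {}"
proof -
  have "v \<notin> branch l i \<and> v \<in> branch k i" if "(k, v) \<in> (E - {(k, i), (i, k)})\<^sup>*" for v
    using that
  proof (induction rule: rtrancl_induct)
    case base
    have "k \<notin> branch l i"
      using branch_step[OF _ k, of l i] ne other_notin_branch[OF l] irrefl l by blast
    then show ?case by (simp add: self_in_branch)
  next
    case (step u v)
    have v: "v \<in> branch k i"
      using step.hyps by (auto simp: branch_def intro: rtrancl_into_rtrancl)
    have "v \<notin> branch l i"
    proof
      assume "v \<in> branch l i"
      moreover have "(v, u) \<in> E"
        using step.hyps sym by blast
      ultimately have "u = i"
        using branch_boundary[OF l] step.IH by blast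
      then show False
        using step.IH other_notin_branch[OF k] by simp
    qed
    then show ?case using v by blast
  qed
  then show ?thesis
    unfolding branch_def by blast
qed

text \<open>The vertex set is the disjoint union of \<open>{i}\<close> and the branches at the neighbours of \<open>i\<close>.\<close>

lemma branches_cover: "UNIV = insert i (\<Union>k\<in>{k. (k, i) \<in> E}. branch k i)"
proof -
  have "v \<in> insert i (\<Union>k\<in>{k. (k, i) \<in> E}. branch k i)" if "(i, v) \<in> E\<^sup>*" for v
    using that
  proof (induction rule: rtrancl_induct)
    case base
    then show ?case by simp
  next
    case (step u v)
    show ?case
    proof (cases "u = i")
      case True
      then show ?thesis
        using step.hyps sym self_in_branch by blast
    next
      case False
      then obtain k where "(k, i) \<in> E" "u \<in> branch k i"
        using step.IH by blast
      then show ?thesis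
        using branch_boundary(2) step.hyps(2) by blast
    qed
  qed
  then show ?thesis
    using conn by blast
qed

lemma sum_branches:
  fixes f :: "'v \<Rightarrow> nat"
  shows "sum f UNIV = f i + (\<Sum>k | (k, i) \<in> E. sum f (branch k i))"
proof -
  let ?N = "{k. (k, i) \<in> E}"
  have "i \<notin> (\<Union>k\<in>?N. branch k i)"
    using other_notin_branch by blast
  then have "sum f UNIV = f i + sum f (\<Union>k\<in>?N. branch k i)"
    by (subst branches_cover[of i]) simp
  also have "sum f (\<Union>k\<in>?N. branch k i) = (\<Sum>k\<in>?N. sum f (branch k i))"
    using branch_disjoint by (intro sum.UNION_disjoint) auto
  finally show ?thesis .
qed

lemma branch_edge:
  assumes "(x, y) \<in> E" "(u, v) \<in> E" "(u, v) \<noteq> (x, y)" "(u, v) \<noteq> (y, x)"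
  shows "u \<in> branch x y \<longleftrightarrow> v \<in> branch x y"
  using branch_step[of u x y v] branch_step[of v x y u] assms sym by blast

lemma branch_opposite:
  assumes "(x, y) \<in> E"
  shows "branch y x = - branch x y"
proof -
  have "branch x y \<inter> branch y x = {}"
  proof -
    have "v \<notin> branch y x" if "(x, v) \<in> (E - {(x, y), (y, x)})\<^sup>*" for v
      using that
    proof (induction rule: rtrancl_induct)
      case base
      show ?case using other_notin_branch sym assms by blast
    next
      case (step u v)
      then show ?case
        using branch_edge[OF sym[OF assms], of u v] by blast
    qed
    then show ?thesis by (auto simp: branch_def)
  qed
  moreover have "v \<in> branch x y \<union> branch y x" if "(x, v) \<in> E\<^sup>*" for v
    using that
  proof (induction rule: rtrancl_induct)
    case base
    show ?case by (simp add: self_in_branch)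
  next
    case (step u v)
    then show ?case
      using branch_step[of u x y v] branch_step[of u y x v] self_in_branch by blast
  qed
  ultimately show ?thesis using conn by blast
qed

text \<open>
  The colour of \<open>v\<close> is the parity of the number of edges that separate \<open>v\<close> from a fixed root \<open>r\<close>.
  For adjacent \<open>u\<close> and \<open>v\<close> the two sets of separating edges differ by the edge \<open>uv\<close> alone.
\<close>

lemma two_colouring:
  obtains col :: "'v \<Rightarrow> bool" where "\<And>x y. (x, y) \<in> E \<Longrightarrow> col x \<noteq> col y"
proof -
  fix r :: 'v
  define D where "D v = {(x, y) \<in> E. r \<in> branch x y \<and> v \<notin> branch x y}" for v
  have D: "\<exists>z. z \<notin> D u \<and> D v = insert z (D u) \<or> z \<notin> D v \<and> D u = insert z (D v)"
    if uv: "(u, v) \<in> E" for u v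
  proof -
    have rest: "e \<in> D u \<longleftrightarrow> e \<in> D v" if "e \<noteq> (u, v)" "e \<noteq> (v, u)" for e
    proof (cases e)
      case (Pair x y)
      then show ?thesis
        using branch_edge[OF _ uv, of x y] that unfolding D_def by blast
    qed
    note opp = branch_opposite[OF uv] other_notin_branch[OF uv]
      other_notin_branch[OF sym[OF uv]] self_in_branch sym[OF uv]
    have inu: "(u, v) \<notin> D u" and inv: "(v, u) \<notin> D v"
      unfolding D_def by (auto simp: self_in_branch)
    show ?thesis
    proof (cases "r \<in> branch u v")
      case True
      have v: "(u, v) \<in> D v" and u: "(v, u) \<notin> D u"
        using True opp uv unfolding D_def by auto
      have "e \<in> D v \<longleftrightarrow> e = (u, v) \<or> e \<in> D u" for e
        using rest[of e] v u inv by metis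
      then have "D v = insert (u, v) (D u)"
        by blast
      with inu show ?thesis by blast
    next
      case False
      have u: "(v, u) \<in> D u" and v: "(u, v) \<notin> D v"
        using False opp uv unfolding D_def by auto
      have "e \<in> D u \<longleftrightarrow> e = (v, u) \<or> e \<in> D v" for e
        using rest[of e] v u inu by metis
      then have "D u = insert (v, u) (D v)"
        by blast
      with inv show ?thesis by blast
    qed
  qed
  have "even (card (D x)) \<noteq> even (card (D y))" if "(x, y) \<in> E" for x y
    using D[OF that] by auto
  then show thesis by (rule that)
qed

section \<open>Peeling off one cover\<close>

lemma peel_cover:
  assumes m: "fractional_cover E (Suc t) m"
  obtains c d where "fractional_cover E 1 c" "fractional_cover E t d" "m = (\<lambda>v. c v + d v)"
proof -
  obtain col :: "'v \<Rightarrow> bool" where col: "\<And>x y. (x, y) \<in> E \<Longrightarrow> col x \<noteq> col y"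
    using two_colouring by blast
  let ?c = "level_cover col True t m"
  have "1 \<le> ?c x + ?c y" "t \<le> (m x - ?c x) + (m y - ?c y)" if "(x, y) \<in> E" for x y
    using level_cover_edge[where m = m, OF col[OF that] cover_edge[OF m that]] by auto
  then have "fractional_cover E 1 ?c" "fractional_cover E t (\<lambda>v. m v - ?c v)"
    by (auto simp: fractional_cover_def)
  moreover have "m = (\<lambda>v. ?c v + (m v - ?c v))"
    by (simp add: level_cover_le)
  ultimately show thesis by (rule that)
qed

text \<open>
  The deficient edge \<open>ij\<close> has weight \<open>t\<close>, so among the levels of both kinds at least one
  contains exactly one of its ends when \<open>t \<ge> 1\<close>.
\<close>

lemma peel_almost_cover:
  assumes m: "almost_cover E (Suc t) i j m" and t: "1 \<le> t"
  obtains c d where "fractional_cover E 1 c" "almost_cover E t i j d" "m = (\<lambda>v. c v + d v)"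
proof -
  obtain col :: "'v \<Rightarrow> bool" where col: "\<And>x y. (x, y) \<in> E \<Longrightarrow> col x \<noteq> col y"
    using two_colouring by blast
  have ij: "(i, j) \<in> E" and mij: "m i + m j = t"
    and rest: "(x, y) \<in> E \<Longrightarrow> (x, y) \<notin> {(i, j), (j, i)} \<Longrightarrow> Suc t \<le> m x + m y" for x y
    using m by (auto simp: almost_cover_def fractional_cover_def)
  \<comment> \<open>If \<open>m i < t\<close>, then \<open>m j \<ge> 1\<close> and the level contains \<open>j\<close> but not \<open>i\<close>; if \<open>m i = t\<close>, then \<open>m j = 0\<close>
    and the level of the other kind contains \<open>i\<close> but not \<open>j\<close>.\<close>
  define b where "b = (if m i < t then col i else col j)"
  let ?c = "level_cover col b t m"
  have e: "?c i + ?c j = 1" "(m i - ?c i) + (m j - ?c j) + 1 = t"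
    using col[OF ij] mij t by (auto simp: level_cover_def b_def)
  have lev: "1 \<le> ?c x + ?c y" "t \<le> (m x - ?c x) + (m y - ?c y)"
    if "(x, y) \<in> E" "(x, y) \<notin> {(i, j), (j, i)}" for x y
    using level_cover_edge[OF col[OF that(1)] rest[OF that], of b] by auto
  have "1 \<le> ?c x + ?c y" if "(x, y) \<in> E" for x y
  proof (cases "(x, y) \<in> {(i, j), (j, i)}")
    case True
    then show ?thesis using e(1) by auto
  next
    case False
    then show ?thesis by (rule lev(1)[OF that])
  qed
  then have "fractional_cover E 1 ?c"
    unfolding fractional_cover_def by blast
  moreover have "almost_cover E t i j (\<lambda>v. m v - ?c v)"
    using ij e(2) lev(2) unfolding almost_cover_def fractional_cover_def by blast
  moreover have "m = (\<lambda>v. ?c v + (m v - ?c v))"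
    by (simp add: level_cover_le)
  ultimately show thesis by (rule that)
qed

text \<open>The number \<open>\<tau>\<close>. Truncating a 1-cover at 1 shows that it is the vertex cover number.\<close>

definition cover_number :: nat where
  "cover_number = (LEAST d. \<exists>c. fractional_cover E 1 c \<and> sum c UNIV = d)"

text \<open>
  The number \<open>\<beta>\<close>: the least weight of an almost cover for \<open>t = 1\<close>, over all edges.
\<close>

definition almost_cover_number :: nat where
  "almost_cover_number = (LEAST d. \<exists>i j c. almost_cover E 1 i j c \<and> sum c UNIV = d)"

lemma cover_number_le: "fractional_cover E 1 c \<Longrightarrow> cover_number \<le> sum c UNIV"
  unfolding cover_number_def by (rule Least_le) blast

lemma almost_cover_number_le: "almost_cover E 1 i j c \<Longrightarrow> almost_cover_number \<le> sum c UNIV"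
  unfolding almost_cover_number_def by (rule Least_le) blast

lemma almost_cover_lower_bound:
  assumes "almost_cover E (Suc t) i j m"
  shows "t * cover_number + almost_cover_number \<le> sum m UNIV"
  using assms
proof (induction t arbitrary: m)
  case 0
  then show ?case using almost_cover_number_le by simp
next
  case (Suc t)
  from Suc.prems obtain c d
    where "fractional_cover E 1 c" "almost_cover E (Suc t) i j d" "m = (\<lambda>v. c v + d v)"
    by (rule peel_almost_cover) auto
  then show ?case
    using Suc.IH[of d] cover_number_le[of c] by (simp add: sum.distrib)
qed

section \<open>Exchange along branches\<close>

lemma minimum_cover_le_1:
  assumes c: "fractional_cover E 1 c" and min: "sum c UNIV = cover_number"
  shows "c v \<le> 1"
proof (rule ccontr)
  assume v: "\<not> c v \<le> 1"
  have "fractional_cover E 1 (c(v := 1))"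
    using c by (auto simp: fractional_cover_def)
  then have "cover_number \<le> sum (c(v := 1)) UNIV"
    by (rule cover_number_le)
  also have "\<dots> < sum c UNIV"
    using v by (intro sum_strict_mono_ex1) auto
  finally show False using min by simp
qed

lemma patch_edge:
  assumes xy: "(x, y) \<in> E" and uv: "(u, v) \<in> E" "(u, v) \<noteq> (x, y)" "(u, v) \<noteq> (y, x)"
    and "t \<le> f u + f v" "t \<le> g u + g v"
  shows "t \<le> patch (branch x y) f g u + patch (branch x y) f g v"
  using branch_edge[OF xy uv] assms(5,6) by (auto simp: patch_def)

lemma patch_ends:
  assumes "(x, y) \<in> E"
  shows "patch (branch x y) f g x = f x" "patch (branch x y) f g y = g y"
  using self_in_branch other_notin_branch[OF assms] by (auto simp: patch_def)

lemma cover_patch_almost_cover: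
  assumes s: "almost_cover E 1 i j s" and c: "fractional_cover E 1 c"
    and e: "(x, y) = (i, j) \<or> (x, y) = (j, i)" and cx: "1 \<le> c x"
  shows "fractional_cover E 1 (patch (branch x y) c s)"
  unfolding fractional_cover_def
proof safe
  fix u v assume uv: "(u, v) \<in> E"
  have xy: "(x, y) \<in> E"
    using s e sym by (auto simp: almost_cover_def)
  show "1 \<le> patch (branch x y) c s u + patch (branch x y) c s v"
  proof (cases "(u, v) = (x, y) \<or> (u, v) = (y, x)")
    case True
    then show ?thesis using patch_ends[OF xy] cx by auto
  next
    case False
    have "1 \<le> s u + s v"
      using s uv False e by (auto simp: almost_cover_def fractional_cover_def)
    then show ?thesis
      using False patch_edge[OF xy uv] cover_edge[OF c uv] by blast
  qed
qed

text \<open>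
  Some minimum cover \<open>c\<close> contains exactly one end of the edge \<open>ij\<close> of an optimal almost cover \<open>s\<close>.
  Suppose not. Both mixtures of \<open>c\<close> and \<open>s\<close> across the edge \<open>ij\<close> are covers that avoid one end, so they
  are not minimum: \<open>s\<close> is heavier than \<open>c\<close> on each side of \<open>ij\<close>. On the side of \<open>i\<close> the
  vertex \<open>i\<close> itself has \<open>s i = 0 < c i\<close>, so \<open>s\<close> is heavier than \<open>c\<close> on the branch at some neighbour
  \<open>k \<noteq> j\<close> of \<open>i\<close>. Replacing \<open>s\<close> by \<open>c\<close> on that branch contradicts the optimality of \<open>s\<close> if \<open>c k > 0\<close>. If
  \<open>c k = 0\<close>, replacing it on the branch at \<open>j\<close> as well repairs \<open>ij\<close> and leaves only the edge \<open>ik\<close>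
  uncovered, again with less weight.
\<close>

lemma exchange:
  assumes s: "almost_cover E 1 i j s" and smin: "sum s UNIV = almost_cover_number"
  obtains c where "fractional_cover E 1 c" "sum c UNIV = cover_number" "c i + c j = 1"
proof -
  have ij: "(i, j) \<in> E" and s0: "s i = 0" "s j = 0"
    and srest: "(x, y) \<in> E \<Longrightarrow> (x, y) \<notin> {(i, j), (j, i)} \<Longrightarrow> 1 \<le> s x + s y" for x y
    using s by (auto simp: almost_cover_def fractional_cover_def)
  note ji = sym[OF ij] and found = that
  have "\<exists>c. fractional_cover E 1 c \<and> sum c UNIV = cover_number"
    unfolding cover_number_def by (rule LeastI_ex) (auto simp: fractional_cover_def intro!: exI[of _ "\<lambda>_. 1"])
  then obtain c where c: "fractional_cover E 1 c" and cmin: "sum c UNIV = cover_number"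
    by blast
  have good: thesis if "fractional_cover E 1 c'" "sum c' UNIV = cover_number" "c' i = 0 \<or> c' j = 0" for c'
  proof (rule found)
    show "c' i + c' j = 1"
      using cover_edge[OF that(1) ij] minimum_cover_le_1[OF that(1,2)] that(3)
      by (metis add.commute add.right_neutral le_antisym)
  qed (use that in auto)
  show thesis
  proof (rule ccontr)
    assume no: "\<not> thesis"
    have ci: "1 \<le> c i"
      using good[OF c cmin] no by (cases "c i") auto
    have cj: "1 \<le> c j"
      using good[OF c cmin] no by (cases "c j") auto
    have opp: "branch i j = - branch j i"
      by (rule branch_opposite[OF ji])
    have lt_j: "sum c (branch j i) < sum s (branch j i)"
    proof (rule ccontr)
      assume ge: "\<not> ?thesis"
      let ?c = "patch (branch i j) c s"
      have cov: "fractional_cover E 1 ?c"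
        using cover_patch_almost_cover[OF s c _ ci] by blast
      have "sum ?c UNIV \<le> cover_number"
        using ge cmin sum_split[of c "branch i j"] unfolding sum_patch opp by simp
      then have "sum ?c UNIV = cover_number"
        using cover_number_le[OF cov] by simp
      then show False
        using good[OF cov] no patch_ends[OF ij] s0 by simp
    qed
    have lt_i: "sum c (- branch j i) < sum s (- branch j i)"
    proof (rule ccontr)
      assume ge: "\<not> ?thesis"
      let ?c = "patch (branch j i) c s"
      have cov: "fractional_cover E 1 ?c"
        using cover_patch_almost_cover[OF s c _ cj] by blast
      have "sum ?c UNIV \<le> cover_number"
        using ge cmin sum_split[of c "branch j i"] unfolding sum_patch by simp
      then have "sum ?c UNIV = cover_number"
        using cover_number_le[OF cov] by simp
      then show False
        using good[OF cov] no patch_ends[OF ji] s0 by simp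
    qed
    let ?N = "{k. (k, i) \<in> E} - {j}"
    have side: "sum f (- branch j i) = f i + (\<Sum>k\<in>?N. sum f (branch k i))" for f :: "'v \<Rightarrow> nat"
    proof -
      have "(\<Sum>k | (k, i) \<in> E. sum f (branch k i)) = sum f (branch j i) + (\<Sum>k\<in>?N. sum f (branch k i))"
        using ji by (intro sum.remove) auto
      then show ?thesis
        using sum_branches[of f i] sum_split[of f "branch j i"] by simp
    qed
    have "(\<Sum>k\<in>?N. sum c (branch k i)) < (\<Sum>k\<in>?N. sum s (branch k i))"
      using lt_i s0 unfolding side by simp
    then obtain k where "k \<in> ?N" and lt_k: "sum c (branch k i) < sum s (branch k i)"
      by (meson not_less sum_mono)
    then have ki: "(k, i) \<in> E" and kj: "k \<noteq> j" by auto
    have disj: "branch k i \<inter> branch j i = {}"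
      by (rule branch_disjoint[OF ki ji kj])
    show False
    proof (cases "c k = 0")
      case False
      let ?s = "patch (branch k i) c s"
      have "almost_cover E 1 i j ?s"
        unfolding almost_cover_def fractional_cover_def
      proof (intro conjI ballI)
        show "(i, j) \<in> E" by (rule ij)
        have "j \<notin> branch k i"
          using disj self_in_branch by blast
        then show "?s i + ?s j + 1 = 1"
          using patch_ends[OF ki] s0 by (simp add: patch_def)
        fix e assume e: "e \<in> E - {(i, j), (j, i)}"
        obtain u v where uv: "e = (u, v)" by (cases e)
        then have E: "(u, v) \<in> E" and ne: "(u, v) \<notin> {(i, j), (j, i)}" using e by auto
        have "1 \<le> ?s u + ?s v"
        proof (cases "(u, v) = (k, i) \<or> (u, v) = (i, k)")
          case True
          then show ?thesis using patch_ends[OF ki] False by auto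
        next
          case False
          then show ?thesis
            using patch_edge[OF ki E] cover_edge[OF c E] srest[OF E ne] by blast
        qed
        then show "case e of (x, y) \<Rightarrow> 1 \<le> ?s x + ?s y" by (simp add: uv)
      qed
      then have "almost_cover_number \<le> sum ?s UNIV"
        by (rule almost_cover_number_le)
      then show False
        using lt_k smin sum_split[of s "branch k i"] unfolding sum_patch by simp
    next
      case True
      let ?g = "patch (branch j i) c s"
      let ?s = "patch (branch k i) c ?g"
      have gcov: "fractional_cover E 1 ?g"
        using cover_patch_almost_cover[OF s c _ cj] by blast
      have "almost_cover E 1 k i ?s"
        unfolding almost_cover_def fractional_cover_def
      proof (intro conjI ballI)
        show "(k, i) \<in> E" by (rule ki)
        show "?s k + ?s i + 1 = 1"
          using patch_ends[OF ki] patch_ends[OF ji] s0 True by simp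
        fix e assume e: "e \<in> E - {(k, i), (i, k)}"
        obtain u v where uv: "e = (u, v)" by (cases e)
        then have E: "(u, v) \<in> E" and ne: "(u, v) \<noteq> (k, i)" "(u, v) \<noteq> (i, k)" using e by auto
        show "case e of (x, y) \<Rightarrow> 1 \<le> ?s x + ?s y"
          using patch_edge[OF ki E ne] cover_edge[OF c E] cover_edge[OF gcov E] by (simp add: uv)
      qed
      then have "almost_cover_number \<le> sum ?s UNIV"
        by (rule almost_cover_number_le)
      also have "\<dots> = sum c (branch k i) + sum ?g (- branch k i)"
        by (rule sum_patch)
      also have "\<dots> < sum s (branch k i) + sum ?g (- branch k i)"
        using lt_k by simp
      also have "sum s (branch k i) = sum ?g (branch k i)"
        using disj by (intro sum.cong) (auto simp: patch_def)
      also have "\<dots> + sum ?g (- branch k i) = sum ?g UNIV"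
        by (rule sum_split[symmetric])
      also have "\<dots> < sum s UNIV"
        using lt_j sum_split[of s "branch j i"] unfolding sum_patch by simp
      finally show False using smin by simp
    qed
  qed
qed

theorem almost_cover_minimum:
  assumes "E \<noteq> {}"
  obtains i j m where "almost_cover E (Suc t) i j m"
    "sum m UNIV = t * cover_number + almost_cover_number"
proof -
  obtain a b where ab: "(a, b) \<in> E" using assms by auto
  have "x \<notin> {a, b} \<or> y \<notin> {a, b}" if "(x, y) \<in> E - {(a, b), (b, a)}" for x y
    using that irrefl by blast
  then have "almost_cover E 1 a b (\<lambda>v. if v \<in> {a, b} then 0 else 1)"
    using ab unfolding almost_cover_def fractional_cover_def by fastforce
  then have "\<exists>d i j s. almost_cover E 1 i j s \<and> sum s UNIV = d"
    by blast
  then have "\<exists>i j s. almost_cover E 1 i j s \<and> sum s UNIV = almost_cover_number"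
    unfolding almost_cover_number_def by (rule LeastI_ex)
  then obtain i j s where s: "almost_cover E 1 i j s" and smin: "sum s UNIV = almost_cover_number"
    by blast
  obtain c where c: "fractional_cover E 1 c" and cmin: "sum c UNIV = cover_number"
    and cij: "c i + c j = 1"
    using exchange[OF s smin] by blast
  have ij: "(i, j) \<in> E" and s0: "s i = 0" "s j = 0"
    and srest: "(x, y) \<in> E \<Longrightarrow> (x, y) \<notin> {(i, j), (j, i)} \<Longrightarrow> 1 \<le> s x + s y" for x y
    using s by (auto simp: almost_cover_def fractional_cover_def)
  let ?m = "\<lambda>v. s v + t * c v"
  have "Suc t \<le> ?m x + ?m y" if "(x, y) \<in> E" "(x, y) \<notin> {(i, j), (j, i)}" for x y
  proof -
    have "t * 1 \<le> t * (c x + c y)"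
      using cover_edge[OF c that(1)] by (rule mult_le_mono2)
    then show ?thesis
      using srest[OF that] by (simp add: distrib_left)
  qed
  moreover have "?m i + ?m j = t * (c i + c j)"
    by (simp add: s0 distrib_left)
  ultimately have "almost_cover E (Suc t) i j ?m"
    using ij cij by (auto simp: almost_cover_def fractional_cover_def)
  moreover have "sum ?m UNIV = t * cover_number + almost_cover_number"
    by (simp add: sum.distrib smin cmin flip: sum_distrib_left)
  ultimately show thesis by (rule that)
qed

end

section \<open>Trees as symmetric digraphs\<close>

text \<open>
  If the edge \<open>xy\<close> were not a bridge, a path from \<open>x\<close> to \<open>y\<close> avoiding it would have length at least
  two and would close up with the arc \<open>(y, x)\<close> to a cycle of length at least three.
\<close>

lemma undirected_tree_edge_tree:
  fixes T :: "'v::finite pair_pre_digraph"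
  assumes T: "undirected_tree T" and V: "pverts T = UNIV"
  shows "edge_tree (parcs T)"
proof -
  interpret pair_graph T
    using T by (simp add: undirected_tree_def)
  show ?thesis
  proof
    fix x y
    show "(x, y) \<in> parcs T \<Longrightarrow> (y, x) \<in> parcs T"
      by (rule arcs_symmetric)
    show "(x, x) \<notin> parcs T"
      using pair_no_loops by fastforce
    have "strongly_connected (mk_symmetric T)"
      using T by (simp add: undirected_tree_def connected_def)
    then have "x \<rightarrow>\<^sup>*\<^bsub>mk_symmetric T\<^esub> y"
      using V by auto
    then have "x \<rightarrow>\<^sup>*\<^bsub>T\<^esub> y"
      using reachable_mk_symmetric_eq[OF sym_arcs] by blast
    then show "(x, y) \<in> (parcs T)\<^sup>*"
      by (auto simp: reachable_def dest: rtrancl_on_rtranclI)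
  next
    fix x y assume xy: "(x, y) \<in> parcs T"
    define H where "H = \<lparr>pverts = (UNIV :: 'v set), parcs = parcs T - {(x, y), (y, x)}\<rparr>"
    have verts_H: "pverts H = UNIV" and arcs_H: "parcs H = parcs T - {(x, y), (y, x)}"
      by (simp_all add: H_def)
    interpret H: pair_wf_digraph H
      by unfold_locales (auto simp: verts_H)
    show "(x, y) \<notin> (parcs T - {(x, y), (y, x)})\<^sup>*"
    proof
      assume "(x, y) \<in> (parcs T - {(x, y), (y, x)})\<^sup>*"
      then have "x \<rightarrow>\<^sup>*\<^bsub>H\<^esub> y"
      proof (induction rule: rtrancl_induct)
        case base
        then show ?case by (intro H.reachable_refl) (simp add: verts_H)
      next
        case (step u v)
        then have "(u, v) \<in> parcs H"
          by (simp add: arcs_H)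
        then show ?case
          using step.IH H.reachable_adj_trans by blast
      qed
      then obtain p where p: "H.apath x p y"
        using H.reachable_apath by blast
      have ne: "x \<noteq> y"
        using pair_no_loops[OF xy] by simp
      have arcs: "set p \<subseteq> parcs T - {(x, y), (y, x)}" and cas: "pcas x p y"
        and dist: "distinct (pawalk_verts x p)"
        using p unfolding H.apath_def H.awalk_def by (auto simp: arcs_H)
      have "2 \<le> length p"
        using arcs cas ne by (cases p; cases "tl p") (auto)
      moreover have "cycle ((y, x) # p)"
        unfolding cycle_def using arcs cas dist V xy arcs_symmetric
        by (intro exI[of _ y]) (auto simp: awalk_def)
      ultimately show False
        using T by (auto simp: undirected_tree_def dest!: spec[of _ "(y, x) # p"])
    qed
  qed
qed

section \<open>Ideals of the polynomial ring spanned by monomials\<close>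

lemma mpoly_ring_simps [simp]:
  "carrier mpoly_ring = UNIV"
  "f \<otimes>\<^bsub>mpoly_ring\<^esub> g = f * g"
  "f \<oplus>\<^bsub>mpoly_ring\<^esub> g = f + g"
  "\<zero>\<^bsub>mpoly_ring\<^esub> = 0"
  "\<one>\<^bsub>mpoly_ring\<^esub> = 1"
  by (simp_all add: ring_of_type_algebra_def)

lemma ring_mpoly_ring: "ring mpoly_ring"
  by (rule ring_from_type_algebra)

lemma cring_mpoly_ring: "cring (mpoly_ring :: ('v::finite, 'k::field) mpoly ring)"
  by (rule cring_from_type_algebra)

lemma ideal_mpolyI:
  fixes I :: "('v::finite, 'k::field) mpoly set"
  assumes zero: "0 \<in> I" and add: "\<And>f g. f \<in> I \<Longrightarrow> g \<in> I \<Longrightarrow> f + g \<in> I"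
    and mult: "\<And>f g. g \<in> I \<Longrightarrow> f * g \<in> I"
  shows "ideal I mpoly_ring"
proof (rule idealI)
  show "ring mpoly_ring" by (rule ring_mpoly_ring)
  interpret ring "mpoly_ring :: ('v, 'k) mpoly ring" by (rule ring_mpoly_ring)
  show "subgroup I (add_monoid mpoly_ring)"
  proof (rule add.subgroupI)
    fix f assume f: "f \<in> I"
    have "- f = \<ominus>\<^bsub>mpoly_ring\<^esub> f"
      by (rule minus_equality[symmetric]) simp_all
    then show "\<ominus>\<^bsub>mpoly_ring\<^esub> f \<in> I"
      using mult[OF f, of "- 1"] by simp
  qed (use assms in auto)
qed (use mult in \<open>auto simp: mult.commute\<close>)

lemma ideal_mpolyD:
  assumes "ideal I (mpoly_ring :: ('v::finite, 'k::field) mpoly ring)"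
  shows "0 \<in> I" "f \<in> I \<Longrightarrow> g \<in> I \<Longrightarrow> f + g \<in> I" "g \<in> I \<Longrightarrow> f * g \<in> I"
proof -
  interpret ideal I "mpoly_ring :: ('v::finite, 'k::field) mpoly ring" by fact
  show "0 \<in> I"
    using additive_subgroup.zero_closed[OF additive_subgroup_axioms] by simp
  show "f + g \<in> I" if "f \<in> I" "g \<in> I"
    using additive_subgroup.a_closed[OF additive_subgroup_axioms that] by simp
  show "f * g \<in> I" if "g \<in> I"
    using I_l_closed[OF that, of f] by simp
qed

lemma sum_single_lookup: "(\<Sum>m\<in>Poly_Mapping.keys f. Poly_Mapping.single m (Poly_Mapping.lookup f m)) = f"
  by (intro poly_mapping_eqI)
    (auto simp: lookup_sum lookup_single when_def sum.delta in_keys_iff)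

lemma ideal_monomialsI:
  assumes I: "ideal I (mpoly_ring :: ('v::finite, 'k::field) mpoly ring)"
    and mon: "\<And>m c. m \<in> Poly_Mapping.keys f \<Longrightarrow> Poly_Mapping.single m c \<in> I"
  shows "f \<in> I"
proof -
  have "sum (\<lambda>m. Poly_Mapping.single m (Poly_Mapping.lookup f m)) A \<in> I"
    if "finite A" "A \<subseteq> Poly_Mapping.keys f" for A
    using that
    by (induction A rule: finite_induct) (auto intro!: ideal_mpolyD[OF I] mon)
  then show ?thesis
    by (metis finite_keys order_refl sum_single_lookup)
qed

text \<open>
  The polynomials all of whose exponent vectors are \<open>t\<close>-covers. This is the intersection of
  the powers \<open>(x\<^sub>i, x\<^sub>j)\<^sup>t\<close> over the edges \<open>ij\<close>; for the single edge \<open>ij\<close> it is that power itself, and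
  \<open>symbolic_power {(i, j)} 1\<close> is the edge prime \<open>(x\<^sub>i, x\<^sub>j)\<close>.
\<close>

definition symbolic_power :: "('v \<times> 'v) set \<Rightarrow> nat \<Rightarrow> ('v::finite, 'k::field) mpoly set" where
  "symbolic_power E t =
     {f. \<forall>m \<in> Poly_Mapping.keys f. fractional_cover E t (Poly_Mapping.lookup m)}"

lemma ideal_symbolic_power: "ideal (symbolic_power E t) mpoly_ring"
proof (rule ideal_mpolyI)
  show "0 \<in> symbolic_power E t"
    by (simp add: symbolic_power_def)
  show "f + g \<in> symbolic_power E t" if "f \<in> symbolic_power E t" "g \<in> symbolic_power E t" for f g
    using that keys_add[of f g] by (auto simp: symbolic_power_def)
  show "f * g \<in> symbolic_power E t" if g: "g \<in> symbolic_power E t" for f g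
    unfolding symbolic_power_def
  proof safe
    fix m assume "m \<in> Poly_Mapping.keys (f * g)"
    then obtain a b where "b \<in> Poly_Mapping.keys g" "m = a + b"
      using keys_mult by blast
    then show "fractional_cover E t (Poly_Mapping.lookup m)"
      using g by (fastforce simp: symbolic_power_def fractional_cover_def lookup_add)
  qed
qed

lemma symbolic_power_mult:
  assumes "f \<in> symbolic_power E s" "g \<in> symbolic_power E t"
  shows "f * g \<in> symbolic_power E (s + t)"
  unfolding symbolic_power_def
proof safe
  fix m assume "m \<in> Poly_Mapping.keys (f * g)"
  then obtain a b where "a \<in> Poly_Mapping.keys f" "b \<in> Poly_Mapping.keys g" "m = a + b"
    using keys_mult by blast
  then show "fractional_cover E (s + t) (Poly_Mapping.lookup m)"
    using assms by (fastforce simp: symbolic_power_def fractional_cover_def lookup_add)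
qed

lemma symbolic_power_power: "f \<in> symbolic_power E 1 \<Longrightarrow> f ^ t \<in> symbolic_power E t"
proof (induction t)
  case 0
  show ?case by (simp add: symbolic_power_def fractional_cover_def)
next
  case (Suc t)
  then show ?case
    using symbolic_power_mult[of f E 1 "f ^ t" t] by simp
qed

lemma symbolic_power_edges:
  "f \<in> symbolic_power E t \<longleftrightarrow> (\<forall>e\<in>E. f \<in> symbolic_power {e} t)"
  by (auto simp: symbolic_power_def fractional_cover_def)

lemma single_in_symbolic_power:
  "fractional_cover E t (Poly_Mapping.lookup m) \<Longrightarrow> Poly_Mapping.single m c \<in> symbolic_power E t"
  by (simp add: symbolic_power_def)

lemma mvar_in_symbolic_power:
  "mvar i \<in> symbolic_power {(i, j)} 1" "mvar j \<in> symbolic_power {(i, j)} 1"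
  unfolding mvar_def
  by (auto intro!: single_in_symbolic_power simp: fractional_cover_def)

lemma single_eq_mult_mvar:
  assumes "1 \<le> Poly_Mapping.lookup m i"
  shows "Poly_Mapping.single m c = Poly_Mapping.single (m - Poly_Mapping.single i 1) c * mvar i"
proof -
  have "m = (m - Poly_Mapping.single i 1) + Poly_Mapping.single i 1"
    using assms by (intro poly_mapping_eqI) (auto simp: lookup_add lookup_minus lookup_single when_def)
  then show ?thesis
    by (simp add: mvar_def mult_single)
qed

lemma edge_ideal_eq: "Idl\<^bsub>mpoly_ring\<^esub> {mvar i, mvar j} = symbolic_power {(i, j)} 1"
proof
  interpret ring mpoly_ring by (rule ring_mpoly_ring)
  show "Idl\<^bsub>mpoly_ring\<^esub> {mvar i, mvar j} \<subseteq> symbolic_power {(i, j)} 1"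
    by (rule genideal_minimal[OF ideal_symbolic_power]) (use mvar_in_symbolic_power in auto)
  have I: "ideal (Idl\<^bsub>mpoly_ring\<^esub> {mvar i, mvar j}) mpoly_ring"
    by (rule genideal_ideal) simp
  have gen: "mvar i \<in> Idl\<^bsub>mpoly_ring\<^esub> {mvar i, mvar j}" "mvar j \<in> Idl\<^bsub>mpoly_ring\<^esub> {mvar i, mvar j}"
    using genideal_self[of "{mvar i, mvar j}"] by auto
  show "symbolic_power {(i, j)} 1 \<subseteq> Idl\<^bsub>mpoly_ring\<^esub> {mvar i, mvar j}"
  proof
    fix f assume f: "f \<in> symbolic_power {(i, j)} 1"
    show "f \<in> Idl\<^bsub>mpoly_ring\<^esub> {mvar i, mvar j}"
    proof (rule ideal_monomialsI[OF I])
      fix m c assume "m \<in> Poly_Mapping.keys f"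
      then have "1 \<le> Poly_Mapping.lookup m i \<or> 1 \<le> Poly_Mapping.lookup m j"
        using f by (fastforce simp: symbolic_power_def fractional_cover_def)
      then show "Poly_Mapping.single m c \<in> Idl\<^bsub>mpoly_ring\<^esub> {mvar i, mvar j}"
        using ideal_mpolyD(3)[OF I gen(1)] ideal_mpolyD(3)[OF I gen(2)]
        by (auto simp only: single_eq_mult_mvar)
    qed
  qed
qed

lemma cover_ideal_eq: "cover_ideal T = symbolic_power (parcs T) 1"
  unfolding cover_ideal_def
  by (auto simp: edge_ideal_eq symbolic_power_edges[of _ "parcs T"])

context edge_tree begin

lemma ideal_prod_symbolic_power:
  "ideal_prod mpoly_ring (symbolic_power E t) (symbolic_power E 1) =
     (symbolic_power E (Suc t) :: ('v, 'k::field) mpoly set)" (is "?P = ?S")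
proof
  show "?P \<subseteq> ?S"
  proof
    fix f assume "f \<in> ?P"
    then show "f \<in> ?S"
    proof induction
      case (prod f g)
      then show ?case using symbolic_power_mult[of f E t g 1] by simp
    next
      case (sum f g)
      then show ?case using ideal_mpolyD(2)[OF ideal_symbolic_power] by simp
    qed
  qed
  interpret ring "mpoly_ring :: ('v, 'k) mpoly ring" by (rule ring_mpoly_ring)
  have I: "ideal ?P mpoly_ring"
    by (intro ideal_prod_is_ideal ideal_symbolic_power)
  show "?S \<subseteq> ?P"
  proof
    fix f :: "('v, 'k) mpoly" assume f: "f \<in> ?S"
    show "f \<in> ?P"
    proof (rule ideal_monomialsI[OF I])
      fix m and a :: 'k assume "m \<in> Poly_Mapping.keys f"
      then have "fractional_cover E (Suc t) (Poly_Mapping.lookup m)"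
        using f by (simp add: symbolic_power_def)
      then obtain c d where cd: "fractional_cover E 1 c" "fractional_cover E t d"
          "Poly_Mapping.lookup m = (\<lambda>v. c v + d v)"
        by (rule peel_cover)
      let ?c = "Poly_Mapping.Abs_poly_mapping c" and ?d = "Poly_Mapping.Abs_poly_mapping d"
      have "m = ?d + ?c"
        by (intro poly_mapping_eqI) (simp add: lookup_add cd(3))
      then have "Poly_Mapping.single m a = Poly_Mapping.single ?d a * Poly_Mapping.single ?c 1"
        by (simp add: mult_single)
      also have "\<dots> \<in> ?P"
        using ideal_prod.prod[of "Poly_Mapping.single ?d a" "symbolic_power E t"
            "Poly_Mapping.single ?c 1" "symbolic_power E 1" mpoly_ring] cd(1,2)
        by (simp add: single_in_symbolic_power)
      finally show "Poly_Mapping.single m a \<in> ?P" .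
    qed
  qed
qed

lemma ideal_power_eq_symbolic_power:
  "ideal_power (symbolic_power E 1) t = (symbolic_power E t :: ('v, 'k::field) mpoly set)"
proof (induction t)
  case 0
  show ?case
    by (auto simp: nat_pow_def ideals_set_def symbolic_power_def fractional_cover_def)
next
  case (Suc t)
  have "ideal_power (symbolic_power E 1) (Suc t) =
      ideal_prod mpoly_ring (ideal_power (symbolic_power E 1) t) (symbolic_power E 1 :: ('v, 'k) mpoly set)"
    by (simp add: nat_pow_def ideals_set_def)
  then show ?case
    by (simp only: Suc ideal_prod_symbolic_power)
qed

end

section \<open>Primary decomposition\<close>

text \<open>
  Two finite nonempty sets of exponent vectors have a sum that arises in only one way: minimise
  one coordinate after the other in both sets. This replaces a monomial order, for which the
  variables would have to be linearly ordered. The induction treats the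
  coordinates in \<open>V\<close>.
\<close>

lemma unique_sum_coordinates:
  fixes A B :: "('v \<Rightarrow>\<^sub>0 nat) set"
  assumes "finite V" "finite A" "A \<noteq> {}" "finite B" "B \<noteq> {}"
  shows "\<exists>a\<in>A. \<exists>b\<in>B. \<forall>m\<in>A. \<forall>n\<in>B. m + n = a + b \<longrightarrow>
    (\<forall>v\<in>V. Poly_Mapping.lookup m v = Poly_Mapping.lookup a v)"
  using assms
proof (induction V arbitrary: A B rule: finite_induct)
  case empty
  then show ?case by auto
next
  case (insert v V)
  define low where "low A = {m\<in>A. Poly_Mapping.lookup m v = (MIN n\<in>A. Poly_Mapping.lookup n v)}"
    for A :: "('v \<Rightarrow>\<^sub>0 nat) set"
  have low: "finite (low A)" "low A \<noteq> {}"
    "\<And>a m. a \<in> low A \<Longrightarrow> m \<in> A \<Longrightarrow> Poly_Mapping.lookup a v \<le> Poly_Mapping.lookup m v"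
    "\<And>a m. a \<in> low A \<Longrightarrow> m \<in> A \<Longrightarrow> Poly_Mapping.lookup a v = Poly_Mapping.lookup m v \<Longrightarrow> m \<in> low A"
    if "finite A" "A \<noteq> {}" for A :: "('v \<Rightarrow>\<^sub>0 nat) set"
  proof -
    have "(MIN n\<in>A. Poly_Mapping.lookup n v) \<in> (\<lambda>n. Poly_Mapping.lookup n v) ` A"
      using that by (intro Min_in) auto
    then show "low A \<noteq> {}" by (auto simp: low_def)
  qed (use that in \<open>auto simp: low_def\<close>)
  note lowA = low[OF insert.prems(1,2)] and lowB = low[OF insert.prems(3,4)]
  obtain a b where ab: "a \<in> low A" "b \<in> low B"
    and uniq: "\<And>m n. m \<in> low A \<Longrightarrow> n \<in> low B \<Longrightarrow> m + n = a + b \<Longrightarrow>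
      (\<forall>u\<in>V. Poly_Mapping.lookup m u = Poly_Mapping.lookup a u)"
    using insert.IH[OF lowA(1,2) lowB(1,2)] by blast
  have "\<forall>u\<in>insert v V. Poly_Mapping.lookup m u = Poly_Mapping.lookup a u"
    if m: "m \<in> A" and n: "n \<in> B" and eq: "m + n = a + b" for m n
  proof -
    have "Poly_Mapping.lookup m v + Poly_Mapping.lookup n v = Poly_Mapping.lookup a v + Poly_Mapping.lookup b v"
      using eq by (metis lookup_add)
    moreover have "Poly_Mapping.lookup a v \<le> Poly_Mapping.lookup m v"
      "Poly_Mapping.lookup b v \<le> Poly_Mapping.lookup n v"
      using lowA(3)[OF ab(1) m] lowB(3)[OF ab(2) n] .
    ultimately have "Poly_Mapping.lookup a v = Poly_Mapping.lookup m v"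
      "Poly_Mapping.lookup b v = Poly_Mapping.lookup n v"
      by simp_all
    moreover from this have "m \<in> low A" "n \<in> low B"
      using lowA(4)[OF ab(1) m] lowB(4)[OF ab(2) n] by simp_all
    ultimately show ?thesis
      using uniq[OF _ _ eq] by simp
  qed
  moreover have "a \<in> A" "b \<in> B"
    using ab by (auto simp: low_def)
  ultimately show ?case by blast
qed

lemma unique_sum:
  fixes A B :: "('v::finite \<Rightarrow>\<^sub>0 nat) set"
  assumes "finite A" "A \<noteq> {}" "finite B" "B \<noteq> {}"
  obtains a b where "a \<in> A" "b \<in> B" "\<And>m n. m \<in> A \<Longrightarrow> n \<in> B \<Longrightarrow> m + n = a + b \<Longrightarrow> m = a"
proof -
  obtain a b where "a \<in> A" "b \<in> B" and
    "\<forall>m\<in>A. \<forall>n\<in>B. m + n = a + b \<longrightarrow>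
      (\<forall>v\<in>UNIV. Poly_Mapping.lookup m v = Poly_Mapping.lookup a v)"
    using unique_sum_coordinates[of UNIV, OF finite assms] by blast
  then show thesis
    by (intro that) (auto intro: poly_mapping_eqI)
qed

lemma lookup_mult_unique:
  fixes f g :: "('v::finite, 'k::field) mpoly"
  assumes "\<And>m n. m \<in> Poly_Mapping.keys f \<Longrightarrow> n \<in> Poly_Mapping.keys g \<Longrightarrow> m + n = a + b \<Longrightarrow> m = a"
  shows "Poly_Mapping.lookup (f * g) (a + b) = Poly_Mapping.lookup f a * Poly_Mapping.lookup g b"
proof -
  let ?h = "\<lambda>l. Poly_Mapping.lookup f l * (\<Sum>q. Poly_Mapping.lookup g q when a + b = l + q)"
  have "?h l = 0" if "l \<noteq> a" for l
  proof (cases "l \<in> Poly_Mapping.keys f")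
    case True
    have "Poly_Mapping.lookup g q = 0" if "a + b = l + q" for q
      using assms[OF True, of q] that \<open>l \<noteq> a\<close> by (metis in_keys_iff)
    then have "(Poly_Mapping.lookup g q when a + b = l + q) = 0" for q
      by (simp add: when_def)
    then show ?thesis by simp
  qed (simp add: in_keys_iff)
  then have "Sum_any ?h = ?h a"
    by (subst Sum_any.expand_superset[of "{a}"]) auto
  also have "(\<Sum>q. Poly_Mapping.lookup g q when a + b = a + q) = Poly_Mapping.lookup g b"
    by simp
  finally show ?thesis
    by (simp add: lookup_mult)
qed

text \<open>
  The power \<open>(x\<^sub>i, x\<^sub>j)\<^sup>t\<close> is \<open>(x\<^sub>i, x\<^sub>j)\<close>-primary: with respect to the degree \<open>w\<close> in \<open>x\<^sub>i, x\<^sub>j\<close>, the lowest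
  components of \<open>f\<close> and \<open>g\<close> have a nonzero product.
\<close>

lemma symbolic_power_edge_primary:
  fixes f g :: "('v::finite, 'k::field) mpoly"
  assumes fg: "g * f \<in> symbolic_power {(i, j)} t" and f: "f \<notin> symbolic_power {(i, j)} t"
  shows "g \<in> symbolic_power {(i, j)} 1"
proof (rule ccontr)
  assume g: "g \<notin> symbolic_power {(i, j)} 1"
  define w where "w m = Poly_Mapping.lookup m i + Poly_Mapping.lookup m j" for m :: "'v \<Rightarrow>\<^sub>0 nat"
  have w_add: "w (m + n) = w m + w n" for m n
    by (simp add: w_def lookup_add)
  obtain f0 where f0: "f0 \<in> Poly_Mapping.keys f" "w f0 < t"
    using f by (auto simp: symbolic_power_def fractional_cover_def w_def not_le)
  obtain g0 where g0: "g0 \<in> Poly_Mapping.keys g" "w g0 = 0"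
    using g by (auto simp: symbolic_power_def fractional_cover_def w_def)
  define d where "d = (MIN m\<in>Poly_Mapping.keys f. w m)"
  define A where "A = {m \<in> Poly_Mapping.keys f. w m = d}"
  define B where "B = {m \<in> Poly_Mapping.keys g. w m = 0}"
  have d_le: "d \<le> w m" if "m \<in> Poly_Mapping.keys f" for m
    using that by (simp add: d_def)
  have "d \<in> w ` Poly_Mapping.keys f"
    unfolding d_def using f0 by (intro Min_in) auto
  then have "A \<noteq> {}" by (auto simp: A_def)
  moreover have "B \<noteq> {}" using g0 by (auto simp: B_def)
  ultimately obtain b a where ab: "b \<in> B" "a \<in> A"
    and uniq: "\<And>n m. n \<in> B \<Longrightarrow> m \<in> A \<Longrightarrow> n + m = b + a \<Longrightarrow> n = b"
    using unique_sum[of B A] by (auto simp: A_def B_def)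
  have "n = b" if "n \<in> Poly_Mapping.keys g" "m \<in> Poly_Mapping.keys f" "n + m = b + a" for m n
  proof -
    have "w n + w m = d"
      using ab that(3) w_add by (metis (mono_tags, lifting) A_def B_def add_0 mem_Collect_eq)
    then have "n \<in> B" "m \<in> A"
      using d_le[OF that(2)] that(1,2) by (auto simp: A_def B_def)
    then show ?thesis using uniq that(3) by blast
  qed
  then have "Poly_Mapping.lookup (g * f) (b + a) = Poly_Mapping.lookup g b * Poly_Mapping.lookup f a"
    by (rule lookup_mult_unique)
  also have "\<dots> \<noteq> 0"
    using ab by (auto simp: A_def B_def in_keys_iff)
  finally have "b + a \<in> Poly_Mapping.keys (g * f)"
    by (simp add: in_keys_iff)
  then have "t \<le> w (b + a)"
    using fg by (auto simp: symbolic_power_def fractional_cover_def w_def)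
  then show False
    using ab f0 d_le[OF f0(1)] by (simp add: w_add A_def B_def)
qed

lemma one_notin_symbolic_power: "E \<noteq> {} \<Longrightarrow> 1 \<le> t \<Longrightarrow> 1 \<notin> symbolic_power E t"
  by (auto simp: symbolic_power_def fractional_cover_def)

lemma primeideal_symbolic_power_edge: "primeideal (symbolic_power {(i, j)} 1) mpoly_ring"
proof (rule primeidealI[OF ideal_symbolic_power cring_mpoly_ring])
  show "carrier mpoly_ring \<noteq> symbolic_power {(i, j)} 1"
    using one_notin_symbolic_power[of "{(i, j)}" 1] by auto
qed (use symbolic_power_edge_primary in auto)

lemma keys_mult_single:
  fixes f :: "('v::finite, 'k::field) mpoly"
  shows "Poly_Mapping.keys (f * Poly_Mapping.single a 1) = (\<lambda>m. m + a) ` Poly_Mapping.keys f"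
proof
  show "Poly_Mapping.keys (f * Poly_Mapping.single a 1) \<subseteq> (\<lambda>m. m + a) ` Poly_Mapping.keys f"
    using keys_mult[of f "Poly_Mapping.single a 1"] by auto
  have "Poly_Mapping.lookup (f * Poly_Mapping.single a 1) (m + a) = Poly_Mapping.lookup f m" for m
    by (subst lookup_mult_unique) auto
  then show "(\<lambda>m. m + a) ` Poly_Mapping.keys f \<subseteq> Poly_Mapping.keys (f * Poly_Mapping.single a 1)"
    by (auto simp: in_keys_iff)
qed

lemma colon_monomial:
  assumes "almost_cover E t i j (Poly_Mapping.lookup m)"
  shows "colon_ideal mpoly_ring (symbolic_power E t) (Poly_Mapping.single m 1) =
    (symbolic_power {(i, j)} 1 :: ('v::finite, 'k::field) mpoly set)"
proof -
  have ij: "(i, j) \<in> E" and mij: "Poly_Mapping.lookup m i + Poly_Mapping.lookup m j + 1 = t"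
    and rest: "\<And>x y. (x, y) \<in> E \<Longrightarrow> (x, y) \<notin> {(i, j), (j, i)} \<Longrightarrow>
      t \<le> Poly_Mapping.lookup m x + Poly_Mapping.lookup m y"
    using assms by (auto simp: almost_cover_def fractional_cover_def)
  have "fractional_cover E t (Poly_Mapping.lookup (n + m)) \<longleftrightarrow>
      fractional_cover {(i, j)} 1 (Poly_Mapping.lookup n)" for n
  proof
    assume "fractional_cover E t (Poly_Mapping.lookup (n + m))"
    then show "fractional_cover {(i, j)} 1 (Poly_Mapping.lookup n)"
      using ij mij by (fastforce simp: fractional_cover_def lookup_add)
  next
    assume n: "fractional_cover {(i, j)} 1 (Poly_Mapping.lookup n)"
    have "t \<le> Poly_Mapping.lookup (n + m) x + Poly_Mapping.lookup (n + m) y" if "(x, y) \<in> E" for x y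
      using rest[OF that] mij n
      by (cases "(x, y) \<in> {(i, j), (j, i)}") (auto simp: fractional_cover_def lookup_add)
    then show "fractional_cover E t (Poly_Mapping.lookup (n + m))"
      by (auto simp: fractional_cover_def)
  qed
  then show ?thesis
    by (auto simp: colon_ideal_def symbolic_power_def keys_mult_single)
qed

text \<open>
  The exponent \<open>m\<close> is any monomial of \<open>f\<close> outside the symbolic power. Both \<open>x\<^sub>i\<close> and \<open>x\<^sub>j\<close> multiply it into
  the symbolic power; an edge other than \<open>ij\<close> misses \<open>i\<close> or \<open>j\<close>, so it has weight at
  least \<open>t\<close> already in \<open>m\<close>.
\<close>

lemma colon_edge_ideal_almost_cover:
  fixes f :: "('v::finite, 'k::field) mpoly"
  assumes colon: "colon_ideal mpoly_ring (symbolic_power E t) f = symbolic_power {(i, j)} 1"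
    and E: "(i, j) \<in> E" and ij: "i \<noteq> j"
  obtains m where "m \<in> Poly_Mapping.keys f" "almost_cover E t i j (Poly_Mapping.lookup m)"
proof -
  let ?l = Poly_Mapping.lookup
  have "1 \<notin> colon_ideal mpoly_ring (symbolic_power E t) f"
    unfolding colon by (rule one_notin_symbolic_power) auto
  then have "f \<notin> symbolic_power E t"
    by (simp add: colon_ideal_def)
  then obtain m where m: "m \<in> Poly_Mapping.keys f" and nc: "\<not> fractional_cover E t (?l m)"
    by (auto simp: symbolic_power_def)
  have shift: "fractional_cover E t (?l (m + Poly_Mapping.single v 1))" if "v \<in> {i, j}" for v
  proof -
    have "mvar v \<in> colon_ideal mpoly_ring (symbolic_power E t) f"
      unfolding colon using that mvar_in_symbolic_power by auto
    then have "f * Poly_Mapping.single (Poly_Mapping.single v 1) 1 \<in> symbolic_power E t"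
      by (simp add: colon_ideal_def mvar_def mult.commute)
    then show ?thesis
      using m by (simp add: symbolic_power_def keys_mult_single)
  qed
  have up: "t \<le> ?l m x + (1 when x = v) + (?l m y + (1 when y = v))"
    if "(x, y) \<in> E" "v \<in> {i, j}" for x y v
    using cover_edge[OF shift[OF that(2)] that(1)]
    by (simp add: lookup_add lookup_single eq_commute[of v])
  have other: "t \<le> ?l m x + ?l m y" if "(x, y) \<in> E" "(x, y) \<notin> {(i, j), (j, i)}" for x y
    using up[OF that(1), of i] up[OF that(1), of j] that(2) ij
    by (auto simp: when_def split: if_splits)
  obtain x y where xy: "(x, y) \<in> E" "?l m x + ?l m y < t"
    using nc by (auto simp: fractional_cover_def not_le)
  then have "(x, y) \<in> {(i, j), (j, i)}"
    using other[OF xy(1)] by (meson not_le)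
  then have "?l m i + ?l m j < t"
    using xy(2) by (auto simp: add.commute)
  moreover have "t \<le> ?l m i + ?l m j + 1"
    using up[OF E, of i] ij by simp
  ultimately have "almost_cover E t i j (?l m)"
    using E other by (auto simp: almost_cover_def fractional_cover_def)
  with m show thesis by (rule that)
qed

text \<open>
  If \<open>P = I : f\<close> contained none of the primes \<open>(x\<^sub>i, x\<^sub>j)\<close> of the edges with \<open>f \<notin> (x\<^sub>i, x\<^sub>j)\<^sup>t\<close>, then a
  product of powers of elements \<open>u e\<close> outside \<open>P\<close> would multiply \<open>f\<close> into \<open>I\<close>. So \<open>P\<close> contains one of
  them, and equality follows since \<open>(x\<^sub>i, x\<^sub>j)\<^sup>t\<close> is primary.
\<close>

lemma associated_prime_edge:
  assumes P: "P \<in> associated_primes mpoly_ring (symbolic_power E t :: ('v::finite, 'k::field) mpoly set)"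
  obtains i j where "(i, j) \<in> E" "P = symbolic_power {(i, j)} 1"
proof -
  let ?S = "symbolic_power :: ('v \<times> 'v) set \<Rightarrow> nat \<Rightarrow> ('v, 'k) mpoly set"
  from P obtain f where prime: "primeideal P mpoly_ring"
    and Pf: "P = colon_ideal mpoly_ring (?S E t) f"
    by (auto simp: associated_primes_def)
  have P_iff: "g \<in> P \<longleftrightarrow> g * f \<in> ?S E t" for g
    by (simp add: Pf colon_ideal_def)
  interpret primeideal P "mpoly_ring :: ('v, 'k) mpoly ring" by fact
  have one: "1 \<notin> P"
    using one_imp_carrier I_notcarr by auto
  have mult: "a \<in> P \<or> b \<in> P" if "a * b \<in> P" for a b
    using I_prime[of a b] that by simp
  have pow: "a \<in> P" if "a ^ n \<in> P" for a n
    using that by (induction n) (use one mult in auto)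
  have prod: "\<exists>e\<in>A. u e \<in> P" if "prod u A \<in> P" "finite A" for u :: "'v \<times> 'v \<Rightarrow> _" and A
    using that(2,1) by (induction A rule: finite_induct) (use one mult in auto)
  have "\<exists>e\<in>E. f \<notin> ?S {e} t \<and> ?S {e} 1 \<subseteq> P"
  proof (rule ccontr)
    assume no: "\<not> ?thesis"
    have "\<exists>u. u \<notin> P \<and> (f \<in> ?S {e} t \<or> u \<in> ?S {e} 1)" if "e \<in> E" for e
      using no that one by blast
    then obtain u where u: "\<And>e. e \<in> E \<Longrightarrow> u e \<notin> P"
        "\<And>e. e \<in> E \<Longrightarrow> f \<in> ?S {e} t \<or> u e \<in> ?S {e} 1"
      by metis
    have "(\<Prod>e\<in>E. u e ^ t) * f \<in> ?S {e} t" if e: "e \<in> E" for e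
    proof (cases "f \<in> ?S {e} t")
      case True
      then show ?thesis by (rule ideal_mpolyD(3)[OF ideal_symbolic_power])
    next
      case False
      then have "u e ^ t \<in> ?S {e} t"
        using u(2)[OF e] symbolic_power_power by blast
      then have "((\<Prod>e\<in>E - {e}. u e ^ t) * f) * u e ^ t \<in> ?S {e} t"
        by (rule ideal_mpolyD(3)[OF ideal_symbolic_power])
      also have "((\<Prod>e\<in>E - {e}. u e ^ t) * f) * u e ^ t = (\<Prod>e\<in>E. u e ^ t) * f"
        using e by (simp add: prod.remove[of E e] ac_simps)
      finally show ?thesis .
    qed
    then have "(\<Prod>e\<in>E. u e ^ t) \<in> P"
      unfolding P_iff symbolic_power_edges[of _ E] by blast
    then show False
      using prod[of "\<lambda>e. u e ^ t" E] pow u(1) by auto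
  qed
  then obtain i j where e: "(i, j) \<in> E" "f \<notin> ?S {(i, j)} t" "?S {(i, j)} 1 \<subseteq> P"
    by auto
  have "P \<subseteq> ?S {(i, j)} 1"
    using symbolic_power_edge_primary[OF _ e(2)] e(1) P_iff symbolic_power_edges by blast
  with e show thesis using that by blast
qed

section \<open>The v-number\<close>

lemma homogeneous_single:
  "Poly_Mapping.single m 1 \<in> homogeneous_component (sum (Poly_Mapping.lookup m) UNIV)"
  by (simp add: homogeneous_component_def)

context edge_tree begin

lemma local_v_number_le:
  assumes "almost_cover E t i j m"
  shows "local_v_number (symbolic_power E t :: ('v, 'k::field) mpoly set) (symbolic_power {(i, j)} 1)
    \<le> sum m UNIV"
proof -
  let ?m = "Poly_Mapping.Abs_poly_mapping m"
  have "Poly_Mapping.lookup ?m = m" by simp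
  then show ?thesis
    unfolding local_v_number_def
    using homogeneous_single[of ?m] colon_monomial[of E t i j ?m] assms
    by (intro Least_le bexI[of _ "Poly_Mapping.single ?m 1"]) simp_all
qed

lemma edge_prime_associated:
  assumes "almost_cover E t i j m"
  shows "symbolic_power {(i, j)} 1
    \<in> associated_primes mpoly_ring (symbolic_power E t :: ('v, 'k::field) mpoly set)"
proof -
  have "almost_cover E t i j (Poly_Mapping.lookup (Poly_Mapping.Abs_poly_mapping m))"
    using assms by simp
  from colon_monomial[OF this] show ?thesis
    unfolding associated_primes_def using primeideal_symbolic_power_edge by auto
qed

text \<open>
  The minimum defining the local v-number is attained because the monomial of an almost cover
  found in any \<open>f\<close> with \<open>I : f = P\<close> is a homogeneous witness.
\<close>

lemma local_v_number_ge:
  assumes P: "P \<in> associated_primes mpoly_ring (symbolic_power E (Suc t) :: ('v, 'k::field) mpoly set)"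
  shows "t * cover_number + almost_cover_number \<le> local_v_number (symbolic_power E (Suc t)) P"
proof -
  let ?I = "symbolic_power E (Suc t) :: ('v, 'k) mpoly set"
  obtain i j where ij: "(i, j) \<in> E" and P_eq: "P = symbolic_power {(i, j)} 1"
    using P by (rule associated_prime_edge)
  have ne: "i \<noteq> j"
    using ij irrefl by blast
  have witness: "\<exists>m\<in>Poly_Mapping.keys f. almost_cover E (Suc t) i j (Poly_Mapping.lookup m)"
    if "colon_ideal mpoly_ring ?I f = P" for f
    using colon_edge_ideal_almost_cover[OF that[unfolded P_eq] ij ne] by blast
  obtain f where "colon_ideal mpoly_ring ?I f = P"
    using P by (auto simp: associated_primes_def)
  then obtain m where "almost_cover E (Suc t) i j (Poly_Mapping.lookup m)"
    using witness by blast
  then have "\<exists>f\<in>homogeneous_component (sum (Poly_Mapping.lookup m) UNIV). colon_ideal mpoly_ring ?I f = P"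
    unfolding P_eq using colon_monomial homogeneous_single by blast
  then have "\<exists>f\<in>homogeneous_component (local_v_number ?I P). colon_ideal mpoly_ring ?I f = P"
    unfolding local_v_number_def by (rule LeastI)
  then obtain g where g: "g \<in> homogeneous_component (local_v_number ?I P)"
    and "colon_ideal mpoly_ring ?I g = P"
    by blast
  then obtain n where n: "n \<in> Poly_Mapping.keys g" "almost_cover E (Suc t) i j (Poly_Mapping.lookup n)"
    using witness by blast
  have "local_v_number ?I P = sum (Poly_Mapping.lookup n) UNIV"
    using g n(1) by (simp add: homogeneous_component_def)
  then show ?thesis
    using almost_cover_lower_bound[OF n(2)] by simp
qed

lemma v_number_symbolic_power:
  assumes "E \<noteq> {}"
  shows "v_number (symbolic_power E (Suc t) :: ('v, 'k::field) mpoly set) =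
    t * cover_number + almost_cover_number"
proof -
  let ?I = "symbolic_power E (Suc t) :: ('v, 'k) mpoly set"
  obtain i j m where m: "almost_cover E (Suc t) i j m"
    and sum: "sum m UNIV = t * cover_number + almost_cover_number"
    using almost_cover_minimum[OF assms] by blast
  have ass: "symbolic_power {(i, j)} 1 \<in> associated_primes mpoly_ring ?I"
    by (rule edge_prime_associated[OF m])
  have "local_v_number ?I (symbolic_power {(i, j)} 1) \<le> t * cover_number + almost_cover_number"
    using local_v_number_le[OF m] unfolding sum .
  moreover note local_v_number_ge[OF ass]
  ultimately have "local_v_number ?I (symbolic_power {(i, j)} 1) = t * cover_number + almost_cover_number"
    by (rule antisym)
  then show ?thesis
    unfolding v_number_def using ass local_v_number_ge
    by (intro cInf_eq_minimum) (force, blast)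
qed

end

theorem theorem1p2:
  fixes T :: "'v::finite pair_pre_digraph"
  assumes "undirected_tree T"
    and "pverts T = UNIV"
    and "parcs T \<noteq> {}"
  shows "\<exists>a b :: int. \<forall>t :: nat. 1 \<le> t \<longrightarrow>
    int (v_number (ideal_power (cover_ideal T :: ('v, 'k::field) mpoly set) t)) = a * int t + b"
proof -
  interpret edge_tree "parcs T"
    using assms(1,2) by (rule undirected_tree_edge_tree)
  have "int (v_number (ideal_power (cover_ideal T :: ('v, 'k) mpoly set) t)) =
      int cover_number * int t + (int almost_cover_number - int cover_number)"
    if "1 \<le> t" for t
  proof -
    obtain s where t: "t = Suc s"
      using \<open>1 \<le> t\<close> by (cases t) auto
    have "v_number (ideal_power (cover_ideal T :: ('v, 'k) mpoly set) t) =
        s * cover_number + almost_cover_number"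
      unfolding cover_ideal_eq ideal_power_eq_symbolic_power t
      by (rule v_number_symbolic_power[OF assms(3)])
    then show ?thesis
      by (simp add: t algebra_simps)
  qed
  then show ?thesis by blast
qed

end
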